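(* Any target function $\phi$ with $\alpha(\phi)<1$ is not a gathering algorithm; equivalently, any (non-empty) set $\Phi$ of target functions such that $\alpha(\Phi)<1$ is not compatible with respect to the gathering problem.
   Context: Robot model. Robots $r_1,\dots,r_n$ are points in the plane $\mathbb{R}^2$, which carries a fixed right-handed global coordinate system $Z_0$. Time is discrete, $t=0,1,2,\dots$; $\mathbf{x}_t(r_i)$ is the position of $r_i$ at time $t$ in $Z_0$, and the configuration at $t$ is the multiset $P_t=\{\mathbf{x}_t(r_i):1\le i\le n\}$. Robot $r_i$ has a local coordinate system $Z_i$, right-handed, with its own unit length and axis directions (arbitrary, fixed over time), whose origin is always the current position of $r_i$; $\gamma_i$ denotes the coordinate transformation from $Z_i$ to $Z_0$ (an orientation-preserving similarity with $\gamma_i((0,0))=\mathbf{x}_t(r_i)$ at time $t$). A target function $\phi$ assigns to every multiset $P$ of $n$ points of $\mathbb{R}^2$ (for every $n\ge1$) an element of $\mathbb{R}^2\cup\{\bot\}$, with $\phi(P)=\bot$ if and only if $(0,0)\notin P$. Each robot $r_i$ is assigned a target function $\phi_i$. The scheduler is semi-synchronous: at each time $t$ an arbitrary subset of robots is activated; if $r_i$ is activated at $t$ then $\mathbf{x}_{t+1}(r_i)=\gamma_i(\phi_i(\gamma_i^{-1}(P_t)))$, otherwise $\mathbf{x}_{t+1}(r_i)=\mathbf{x}_t(r_i)$. The schedule is fair: every robot is activated infinitely often. The resulting sequence $P_0,P_1,\dots$ is an execution. There are no faulty robots. Scale. $CH(P)$ is the convex hull of $P$, $g(P)=\frac1n\sum_{\mathbf{x}\in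 P}\mathbf{x}$ (with multiplicity), and $d*CH(P)=\{d\mathbf{x}+(1-d)g(P):\mathbf{x}\in CH(P)\}$ for $d\ge0$. $\alpha(\phi,P)$ is the smallest $d\ge 0$ with $\phi(P)\in d*CH(P)$ (and $0$ if $\phi(P)=\bot$; $\infty$ if there is no such $d$). $\alpha(\phi)=\sup_P\alpha(\phi,P)$ and $\alpha(\Phi)=\sup_{\phi\in\Phi}\alpha(\phi)$. Compatibility. $\Phi$ is compatible with respect to the gathering problem if, for every number $n\ge3$ of robots, every assignment of target functions from $\Phi$ to the robots (different robots may get different ones), every choice of local coordinate systems, every initial configuration in which the robots occupy distinct points, and every fair schedule, the robots gather at exactly the same point within finite time, i.e., there are a point $\mathbf{q}$ and a time $t_0$ such that $\mathbf{x}_t(r_i)=\mathbf{q}$ for all $i$ and all $t\ge t_0$. A target function $\phi$ is a gathering algorithm if $\{\phi\}$ is compatible with respect to the gathering problem. *)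

theory Defs
  imports "HOL-Analysis.Analysis" "HOL-Library.Multiset"
begin

type_synonym point = "real ^ 2"

text \<open>\<open>None\<close> plays the role of \<open>\<bottom>\<close>.\<close>

type_synonym target = "point multiset \<Rightarrow> point option"

definition target_function :: "target \<Rightarrow> bool" where
  "target_function \<phi> \<longleftrightarrow> (\<forall>P. P \<noteq> {#} \<longrightarrow> (\<phi> P = None \<longleftrightarrow> 0 \<notin># P))"


subsection \<open>Scale\<close>

definition centroid :: "point multiset \<Rightarrow> point" where
  "centroid P = (1 / real (size P)) *\<^sub>R sum_mset P"

definition scaled_hull :: "real \<Rightarrow> point multiset \<Rightarrow> point set" where
  "scaled_hull d P = (\<lambda>x. d *\<^sub>R x + (1 - d) *\<^sub>R centroid P) ` (convex hull (set_mset P))"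

text \<open>The infimum is a minimum unless it is \<open>\<infinity>\<close> (the infimum of the empty set); see the
  lemma \<open>alpha_at_attained\<close> below.\<close>

definition alpha_at :: "target \<Rightarrow> point multiset \<Rightarrow> ennreal" where
  "alpha_at \<phi> P = (case \<phi> P of None \<Rightarrow> 0
     | Some y \<Rightarrow> Inf {ennreal d | d. d \<ge> 0 \<and> y \<in> scaled_hull d P})"

definition alpha :: "target \<Rightarrow> ennreal" where
  "alpha \<phi> = (SUP P\<in>{P. P \<noteq> {#}}. alpha_at \<phi> P)"

definition alpha_set :: "target set \<Rightarrow> ennreal" where
  "alpha_set \<Phi> = (SUP \<phi>\<in>\<Phi>. alpha \<phi>)"

lemma alpha_at_attained:
  assumes y: "\<phi> P = Some y" and fin: "alpha_at \<phi> P \<noteq> \<infinity>"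
  shows "\<exists>d\<ge>0. alpha_at \<phi> P = ennreal d \<and> y \<in> scaled_hull d P"
proof -
  define S where "S = {d. d \<ge> 0 \<and> y \<in> scaled_hull d P}"
  have sc: "alpha_at \<phi> P = Inf (ennreal ` S)"
    using y by (auto simp: alpha_at_def S_def intro!: arg_cong[where f = Inf])
  have "S \<noteq> {}"
    using fin sc by auto
  then obtain D where D: "D \<in> S" by blast
  define f where "f = (\<lambda>(d::real, x). d *\<^sub>R x + (1 - d) *\<^sub>R centroid P)"
  define K where "K = ({0..D} \<times> (convex hull (set_mset P))) \<inter> f -` {y}"
  have "continuous_on UNIV f"
    unfolding f_def case_prod_beta by (intro continuous_intros)
  then have "closed (f -` {y})"
    by (intro closed_vimage) auto
  moreover have "compact ({0..D} \<times> (convex hull (set_mset P)))"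
    by (intro compact_Times finite_imp_compact_convex_hull) auto
  ultimately have "compact K"
    unfolding K_def by (rule compact_Int_closed[rotated])
  then have cK: "compact (fst ` K)"
    by (intro compact_continuous_image continuous_intros)
  have K: "fst ` K = S \<inter> {..D}"
    by (force simp: K_def S_def f_def scaled_hull_def image_iff)
  obtain d where d: "d \<in> S" "\<And>e. e \<in> S \<inter> {..D} \<Longrightarrow> d \<le> e"
    using compact_attains_inf[OF cK] D K by auto
  have min: "d \<le> e" if "e \<in> S" for e
    using d(2)[of e] d(2)[of D] D that by (cases "e \<le> D") auto
  have "Inf (ennreal ` S) = ennreal d"
    using d(1) min by (intro antisym Inf_lower Inf_greatest) (auto intro: ennreal_leI)
  then show ?thesis
    using d(1) sc by (auto simp: S_def)
qed


subsection \<open>Executions\<close>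

text \<open>Robots are indexed by \<open>{..<n}\<close>; \<open>x t i\<close> is the position of robot \<open>i\<close> at time \<open>t\<close> in the
  global coordinate system.\<close>

definition config :: "nat \<Rightarrow> (nat \<Rightarrow> nat \<Rightarrow> point) \<Rightarrow> nat \<Rightarrow> point multiset" where
  "config n x t = image_mset (x t) (mset_set {..<n})"

text \<open>The coordinate transformation from the local to the global system, for a local system
  with origin \<open>p\<close>, unit length \<open>u > 0\<close> (measured globally) and axis directions the columns of
  \<open>R\<close>.  Right-handedness is the condition that \<open>R\<close> is a rotation matrix, i.e. orthogonal with
  determinant 1.\<close>

definition to_global :: "real \<Rightarrow> real ^ 2 ^ 2 \<Rightarrow> point \<Rightarrow> point \<Rightarrow> point" where
  "to_global u R p v = p + u *\<^sub>R (R *v v)"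

lemma bij_to_global:
  assumes "u > 0" "rotation_matrix R"
  shows "bij (to_global u R p)"
proof (rule bij_betw_byWitness[where f' = "\<lambda>w. (1 / u) *\<^sub>R (transpose R *v (w - p))"])
  have "R ** transpose R = mat 1" "transpose R ** R = mat 1"
    using assms(2) by (auto simp: rotation_matrix_def orthogonal_matrix_def)
  then show "\<forall>v\<in>UNIV. (1 / u) *\<^sub>R (transpose R *v (to_global u R p v - p)) = v"
    and "\<forall>w\<in>UNIV. to_global u R p ((1 / u) *\<^sub>R (transpose R *v (w - p))) = w"
    using assms(1) by (auto simp: to_global_def matrix_vector_mult_scaleR matrix_vector_mul_assoc
        simp del: transpose_matrix_vector)
qed auto

definition local_frames :: "nat \<Rightarrow> (nat \<Rightarrow> real) \<Rightarrow> (nat \<Rightarrow> real ^ 2 ^ 2) \<Rightarrow> bool" where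
  "local_frames n u R \<longleftrightarrow> (\<forall>i<n. u i > 0 \<and> rotation_matrix (R i))"

definition fair_schedule :: "nat \<Rightarrow> (nat \<Rightarrow> nat set) \<Rightarrow> bool" where
  "fair_schedule n A \<longleftrightarrow> (\<forall>t. A t \<subseteq> {..<n}) \<and> (\<forall>i<n. infinite {t. i \<in> A t})"

text \<open>For an activated robot the observed multiset contains the origin, so that a target function
  never returns \<open>None\<close> there and the equation determines the new position.\<close>

definition execution ::
  "nat \<Rightarrow> (nat \<Rightarrow> target) \<Rightarrow> (nat \<Rightarrow> real) \<Rightarrow> (nat \<Rightarrow> real ^ 2 ^ 2) \<Rightarrow> (nat \<Rightarrow> nat set) \<Rightarrow>
     (nat \<Rightarrow> nat \<Rightarrow> point) \<Rightarrow> bool" where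
  "execution n \<phi>s u R A x \<longleftrightarrow> (\<forall>t. \<forall>i<n.
     let \<gamma> = to_global (u i) (R i) (x t i) in
       if i \<in> A t
       then map_option \<gamma> (\<phi>s i (image_mset (inv \<gamma>) (config n x t))) = Some (x (Suc t) i)
       else x (Suc t) i = x t i)"

definition gathers :: "nat \<Rightarrow> (nat \<Rightarrow> nat \<Rightarrow> point) \<Rightarrow> bool" where
  "gathers n x \<longleftrightarrow> (\<exists>q t\<^sub>0. \<forall>t\<ge>t\<^sub>0. \<forall>i<n. x t i = q)"

definition gathering_compatible :: "target set \<Rightarrow> bool" where
  "gathering_compatible \<Phi> \<longleftrightarrow> (\<forall>n\<ge>3. \<forall>\<phi>s u R A x.
     (\<forall>i<n. \<phi>s i \<in> \<Phi>) \<longrightarrow> local_frames n u R \<longrightarrow> fair_schedule n A \<longrightarrow>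
     inj_on (x 0) {..<n} \<longrightarrow> execution n \<phi>s u R A x \<longrightarrow> gathers n x)"

definition gathering_algorithm :: "target \<Rightarrow> bool" where
  "gathering_algorithm \<phi> \<longleftrightarrow> gathering_compatible {\<phi>}"

end

theory Submission
  imports Defs
begin

text \<open>Activate the robots one at a time, in round-robin order. Just before a gathering at \<open>q\<close>, all
  robots but the activated one, at some \<open>p \<noteq> q\<close>, would already be at \<open>q\<close>, so that the activated
  robot would have to move to the end point \<open>q\<close> of the segment spanned by the configuration. The
  centroid lies in the interior of this segment, and scaling the segment by a factor less than 1
  about the centroid excludes its end points. Hence the robots never gather.\<close>

text \<open>The coefficient of \<open>p - q\<close> is positive for every \<open>m\<close>, so the
  centroid differs from \<open>q\<close> as soon as \<open>p\<close> does.\<close>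

lemma centroid_add_replicate:
  "centroid (add_mset p (replicate_mset m q)) = q + (1 / real (Suc m)) *\<^sub>R (p - q)"
proof -
  have sum: "sum_mset (replicate_mset m q) = real m *\<^sub>R q"
    by (induction m) (auto simp: algebra_simps)
  have "real (Suc m) *\<^sub>R q + (p - q) = p + real m *\<^sub>R q"
    by (simp add: algebra_simps)
  then have "(1 / real (Suc m)) *\<^sub>R (p + real m *\<^sub>R q)
      = (1 / real (Suc m)) *\<^sub>R (real (Suc m) *\<^sub>R q + (p - q))"
    by simp
  also have "\<dots> = q + (1 / real (Suc m)) *\<^sub>R (p - q)"
    by (simp only: scaleR_add_right scaleR_scaleR) simp
  finally show ?thesis
    by (simp add: centroid_def sum del: sum_mset_replicate_mset)
qed

text \<open>Measured from \<open>q\<close> in the direction \<open>p - q\<close>, points of the hull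
  have a coefficient \<open>s\<close> \<ge> 0 and the centroid has a positive one. The centroid
  enters with weight \<open>1 - d\<close> > 0, so the combination cannot return to
  \<open>q\<close>.\<close>

lemma end_point_notin_scaled_hull:
  assumes "p \<noteq> q" "0 \<le> d" "d < 1"
  shows "q \<notin> scaled_hull d (add_mset p (replicate_mset m q))"
proof
  let ?P = "add_mset p (replicate_mset m q)"
  assume "q \<in> scaled_hull d ?P"
  then obtain x where x: "x \<in> convex hull (set_mset ?P)"
    and q: "q = d *\<^sub>R x + (1 - d) *\<^sub>R centroid ?P"
    by (auto simp: scaled_hull_def)
  have "convex hull (set_mset ?P) \<subseteq> closed_segment q p"
    unfolding segment_convex_hull by (intro hull_mono) auto
  then have "x \<in> closed_segment q p"
    using x by (rule subsetD)
  then obtain s where s: "0 \<le> s" "x = (1 - s) *\<^sub>R q + s *\<^sub>R p"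
    by (auto simp: in_segment)
  have "0 = d *\<^sub>R x + (1 - d) *\<^sub>R centroid ?P - q"
    using q by simp
  also have "\<dots> = (d * s + (1 - d) / real (Suc m)) *\<^sub>R (p - q)"
    unfolding centroid_add_replicate s(2) by (simp add: algebra_simps)
  finally have "d * s + (1 - d) / real (Suc m) = 0"
    using \<open>p \<noteq> q\<close> by simp
  moreover have "d * s + (1 - d) / real (Suc m) > 0"
    using assms s(1) by (intro add_nonneg_pos mult_nonneg_nonneg divide_pos_pos) auto
  ultimately show False by simp
qed

text \<open>The supremum bounds \<open>alpha_at\<close> at this multiset strictly below 1, and the
  infimum defining \<open>alpha_at\<close> is attained. This yields an actual factor
  \<open>d\<close> < 1 to which the exclusion of end points applies.\<close>

lemma target_not_end_point:
  assumes "alpha \<phi> < 1" "p \<noteq> q"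
  shows "\<phi> (add_mset p (replicate_mset m q)) \<noteq> Some q"
proof
  let ?P = "add_mset p (replicate_mset m q)"
  assume eq: "\<phi> ?P = Some q"
  have "alpha_at \<phi> ?P \<le> alpha \<phi>"
    unfolding alpha_def by (rule SUP_upper) simp
  then have lt: "alpha_at \<phi> ?P < 1"
    using assms(1) by simp
  then have "alpha_at \<phi> ?P \<noteq> \<infinity>"
    by auto
  then obtain d where d: "0 \<le> d" "alpha_at \<phi> ?P = ennreal d" "q \<in> scaled_hull d ?P"
    using alpha_at_attained[where \<phi> = \<phi> and P = ?P] eq by blast
  have "d < 1"
    using lt d(1,2) by simp
  then show False
    using end_point_notin_scaled_hull[OF assms(2) d(1)] d(3) by blast
qed

text \<open>The counterexample may choose the local frames, so all are taken as translates of the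
  global one.\<close>

lemma to_global_identity_frame: "to_global 1 (mat 1) p = (+) p"
  by (simp add: to_global_def fun_eq_iff)

lemma inv_translation: "inv ((+) p) = (\<lambda>w. w - p)" for p :: point
  by (rule inv_equality) simp_all

text \<open>For a target function and \<open>i < n\<close>, \<open>the\<close> never meets
  \<open>None\<close>: robot \<open>i\<close> observes itself at the origin.\<close>

definition sequential_step :: "nat \<Rightarrow> target \<Rightarrow> nat \<Rightarrow> (nat \<Rightarrow> point) \<Rightarrow> nat \<Rightarrow> point" where
  "sequential_step n \<phi> i X =
     X(i := X i + the (\<phi> (image_mset (\<lambda>j. X j - X i) (mset_set {..<n}))))"

fun round_robin :: "nat \<Rightarrow> target \<Rightarrow> nat \<Rightarrow> nat \<Rightarrow> point" where
  \<comment> \<open>The robots start at distinct points of the diagonal, both coordinates being the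
    index.\<close>
  "round_robin n \<phi> 0 = (\<lambda>i. vec (real i))"
| "round_robin n \<phi> (Suc t) = sequential_step n \<phi> (t mod n) (round_robin n \<phi> t)"

lemma target_defined:
  fixes X :: "nat \<Rightarrow> point"
  assumes "target_function \<phi>" "i < n"
  shows "\<exists>y. \<phi> (image_mset (\<lambda>j. X j - X i) (mset_set {..<n})) = Some y"
proof -
  let ?P = "image_mset (\<lambda>j. X j - X i) (mset_set {..<n})"
  have "i \<in># mset_set {..<n}"
    using assms(2) by simp
  then have "0 \<in># ?P"
    by force
  moreover from this have "?P \<noteq> {#}"
    by (metis empty_iff set_mset_empty)
  ultimately have "\<phi> ?P \<noteq> None"
    using assms(1) unfolding target_function_def by blast
  then show ?thesis
    by (simp only: not_None_eq)
qed

lemma execution_round_robin: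
  assumes "target_function \<phi>"
  shows "execution n (\<lambda>_. \<phi>) (\<lambda>_. 1) (\<lambda>_. mat 1) (\<lambda>t. {..<n} \<inter> {t mod n}) (round_robin n \<phi>)"
proof -
  have "map_option ((+) (X i)) (\<phi> (image_mset (\<lambda>j. X j - X i) (mset_set {..<n})))
      = Some (sequential_step n \<phi> i X i)" if "i < n" for i X
    using target_defined[OF assms that, of X] by (auto simp: sequential_step_def)
  then show ?thesis
    by (auto simp: execution_def Let_def to_global_identity_frame inv_translation config_def
        image_mset.compositionality o_def sequential_step_def)
qed

text \<open>The intersection with \<open>{..<n}\<close> only matters for \<open>n = 0\<close>, where
  \<open>t mod n\<close> is \<open>t\<close>.\<close>

lemma fair_round_robin: "fair_schedule n (\<lambda>t. {..<n} \<inter> {t mod n})"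
proof -
  have "infinite {t. i \<in> {..<n} \<inter> {t mod n}}" if "i < n" for i
  proof (rule infinite_super)
    show "range (\<lambda>k. i + n * k) \<subseteq> {t. i \<in> {..<n} \<inter> {t mod n}}"
      using that by auto
    show "infinite (range (\<lambda>k. i + n * k))"
      using that by (intro range_inj_infinite) (auto simp: inj_on_def)
  qed
  then show ?thesis
    by (auto simp: fair_schedule_def)
qed

text \<open>Gathering is traced backwards through one step: the robots other than \<open>i\<close>
  have not moved, so they were at \<open>q\<close> already, and robot \<open>i\<close> cannot have
  jumped onto them from elsewhere.\<close>

lemma sequential_step_not_gathered:
  assumes \<phi>: "target_function \<phi>" "alpha \<phi> < 1" and i: "i < n"
    and gathered: "\<forall>j<n. sequential_step n \<phi> i X j = q"
  shows "\<forall>j<n. X j = q"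
proof -
  have others: "X j = q" if "j < n" "j \<noteq> i" for j
    using gathered that by (auto simp: sequential_step_def)
  let ?P = "image_mset (\<lambda>j. X j - X i) (mset_set {..<n})"
  have "mset_set {..<n} = add_mset i (mset_set ({..<n} - {i}))"
    using i by (subst mset_set.insert_remove[symmetric]) (auto simp: insert_absorb)
  moreover have "image_mset (\<lambda>j. X j - X i) (mset_set ({..<n} - {i}))
      = image_mset (\<lambda>_. q - X i) (mset_set ({..<n} - {i}))"
    using others by (intro image_mset_cong) auto
  ultimately have P: "?P = add_mset 0 (replicate_mset (n - 1) (q - X i))"
    using i by (simp add: image_mset_const_eq)
  obtain y where y: "\<phi> ?P = Some y"
    using target_defined[OF \<phi>(1) i] by blast
  have "y = q - X i"
    using gathered i y by (auto simp: sequential_step_def algebra_simps)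
  \<comment> \<open>In the frame of robot \<open>i\<close>, the lone point is 0 and the other
    \<open>n - 1\<close> robots share the point \<open>q - X i\<close>. If these differed, the
    target would be the forbidden end point.\<close>
  then have "X i = q"
    using target_not_end_point[OF \<phi>(2), of 0 "q - X i" "n - 1"] y P by auto
  then show ?thesis
    using others by blast
qed

lemma round_robin_not_gathered:
  assumes "target_function \<phi>" "alpha \<phi> < 1" "2 \<le> n"
  shows "\<not> (\<forall>j<n. round_robin n \<phi> t j = q)"
proof (induction t)
  case 0
  have "vec (real 0) \<noteq> (vec (real 1) :: point)"
    by (simp add: vec_eq_iff)
  moreover have "0 < n" "1 < n"
    using assms(3) by auto
  ultimately show ?case
    unfolding round_robin.simps by metis
next
  case (Suc t)
  have "t mod n < n"
    using assms(3) by simp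
  then show ?case
    using Suc sequential_step_not_gathered[OF assms(1,2)] unfolding round_robin.simps by blast
qed

lemma not_gathering_compatible:
  assumes "\<phi> \<in> \<Phi>" "target_function \<phi>" "alpha \<phi> < 1"
  shows "\<not> gathering_compatible \<Phi>"
proof
  assume compat: "gathering_compatible \<Phi>"
  \<comment> \<open>Three robots, all running the same member of \<open>\<Phi>\<close>, suffice to
    refute compatibility.\<close>
  have "inj_on (round_robin 3 \<phi> 0) {..<3}"
    by (auto simp: inj_on_def vec_eq_iff)
  moreover have "local_frames 3 (\<lambda>_. 1) (\<lambda>_. mat 1)"
    by (auto simp: local_frames_def rotation_matrix_def orthogonal_matrix_id)
  moreover have "(3::nat) \<le> 3"
    by simp
  ultimately have "gathers 3 (round_robin 3 \<phi>)"
    using compat execution_round_robin[OF assms(2), of 3] fair_round_robin[of 3] assms(1)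
    unfolding gathering_compatible_def by (metis (no_types, lifting))
  then obtain q t where "\<forall>i<3. round_robin 3 \<phi> t i = q"
    unfolding gathers_def by (metis order_refl)
  then show False
    using round_robin_not_gathered[OF assms(2,3), of 3 t q] by simp
qed

theorem theorem13:
  shows "(\<forall>\<phi>. target_function \<phi> \<longrightarrow> alpha \<phi> < 1 \<longrightarrow> \<not> gathering_algorithm \<phi>) \<and>
         (\<forall>\<Phi>. \<Phi> \<noteq> {} \<longrightarrow> (\<forall>\<phi>\<in>\<Phi>. target_function \<phi>) \<longrightarrow> alpha_set \<Phi> < 1 \<longrightarrow>
            \<not> gathering_compatible \<Phi>)"
proof (intro conjI allI impI)
  fix \<phi>
  assume "target_function \<phi>" "alpha \<phi> < 1"
  then show "\<not> gathering_algorithm \<phi>"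
    unfolding gathering_algorithm_def by (intro not_gathering_compatible[of \<phi>]) auto
next
  fix \<Phi> :: "target set"
  assume "\<Phi> \<noteq> {}" and target: "\<forall>\<phi>\<in>\<Phi>. target_function \<phi>" and small: "alpha_set \<Phi> < 1"
  then obtain \<phi> where \<phi>: "\<phi> \<in> \<Phi>" by blast
  have "alpha \<phi> \<le> alpha_set \<Phi>"
    unfolding alpha_set_def using \<phi> by (rule SUP_upper)
  then show "\<not> gathering_compatible \<Phi>"
    using not_gathering_compatible[OF \<phi>] target \<phi> small by auto
qed

end
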